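(* Let $v$ be a weight on $(0,\infty)$ belonging to both classes $M_1$ and $m_1$. A measurable function $h:(0,\infty)\to\mathbb{R}$ belongs to $\mathrm{Ces}_1(v)$ if and only if it admits a factorization $h=f\cdot g$ with $f\in L^1(v)$ and $g\in L^\infty$. Moreover, for every such $h$, $$[v]_{m_1}\,N(h)\le\|h\|_{\mathrm{Ces}_1(v)}\le[v]_{M_1}\,N(h),$$ where $N(h)=\inf\|f\|_{L^1(v)}\|g\|_\infty$, the infimum being taken over all factorizations $h=f\cdot g$ with $f\in L^1(v)$ and $g\in L^\infty$.
   Context: All functions are real-valued and Lebesgue measurable on $(0,\infty)$; equalities between functions are a.e. A weight is a function $v$ that is positive a.e. and locally integrable on $(0,\infty)$. $\|f\|_{L^1(v)}=\int_0^\infty|f(x)|v(x)\,dx$, and $\|g\|_\infty=\operatorname{ess\,sup}_{x>0}|g(x)|$. $\mathrm{Ces}_1(v)$ is the set of functions $f$ with $$\|f\|_{\mathrm{Ces}_1(v)}=\int_0^\infty\left(\frac1x\int_0^x|f(t)|\,dt\right)v(x)\,dx<\infty.$$ The class $M_1$ consists of the weights $v$ for which there is a constant $C>0$ such that $\int_t^\infty\frac{v(x)}{x}\,dx\le C\,v(t)$ for almost every $t>0$; $[v]_{M_1}$ is the least such $C$. The class $m_1$ consists of the weights $v$ for which the reverse inequality $\int_t^\infty\frac{v(x)}{x}\,dx\ge C\,v(t)$ holds for almost every $t>0$ with some constant $C>0$; $[v]_{m_1}$ is the largest such $C$. *)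

theory Defs
  imports "HOL-Analysis.Analysis" "HOL-Probability.Essential_Supremum"
begin

text \<open>
  Functions on the half-line are total functions of type \<open>real \<Rightarrow> real\<close>; only their
  values on \<open>{0<..}\<close> matter, because everything is measured with \<open>half_line\<close>.
  Integrals of nonnegative functions, and hence all norms, take values in
  \<open>ennreal\<close>.
\<close>

abbreviation half_line :: "real measure" where
  "half_line \<equiv> lebesgue_on {0<..}"

definition weight :: "(real \<Rightarrow> real) \<Rightarrow> bool" where
  "weight v \<longleftrightarrow>
     v \<in> borel_measurable half_line \<and>
     (AE x in half_line. 0 < v x) \<and>
     (\<forall>K. compact K \<and> K \<subseteq> {0<..} \<longrightarrow> v absolutely_integrable_on K)"

definition L1_norm :: "(real \<Rightarrow> real) \<Rightarrow> (real \<Rightarrow> real) \<Rightarrow> ennreal" where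
  "L1_norm v f = (\<integral>\<^sup>+x. ennreal (\<bar>f x\<bar> * v x) \<partial>half_line)"

definition L1_space :: "(real \<Rightarrow> real) \<Rightarrow> (real \<Rightarrow> real) set" where
  "L1_space v = {f \<in> borel_measurable half_line. L1_norm v f < \<infinity>}"

definition Linf_norm :: "(real \<Rightarrow> real) \<Rightarrow> ennreal" where
  "Linf_norm g = esssup half_line (\<lambda>x. ennreal \<bar>g x\<bar>)"

definition Linf_space :: "(real \<Rightarrow> real) set" where
  "Linf_space = {g \<in> borel_measurable half_line. Linf_norm g < \<infinity>}"

definition Ces1_norm :: "(real \<Rightarrow> real) \<Rightarrow> (real \<Rightarrow> real) \<Rightarrow> ennreal" where
  "Ces1_norm v f =
     (\<integral>\<^sup>+x. ennreal (1 / x) * (\<integral>\<^sup>+t. ennreal \<bar>f t\<bar> \<partial>lebesgue_on {0<..<x}) * ennreal (v x) \<partial>half_line)"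

definition Ces1_space :: "(real \<Rightarrow> real) \<Rightarrow> (real \<Rightarrow> real) set" where
  "Ces1_space v = {f \<in> borel_measurable half_line. Ces1_norm v f < \<infinity>}"

definition M1_bound :: "(real \<Rightarrow> real) \<Rightarrow> real \<Rightarrow> bool" where
  "M1_bound v C \<longleftrightarrow> 0 < C \<and>
     (AE t in half_line. (\<integral>\<^sup>+x. ennreal (v x / x) \<partial>lebesgue_on {t<..}) \<le> ennreal (C * v t))"

definition M1_class :: "(real \<Rightarrow> real) set" where
  "M1_class = {v. weight v \<and> (\<exists>C. M1_bound v C)}"

definition M1_const :: "(real \<Rightarrow> real) \<Rightarrow> real" where
  "M1_const v = (LEAST C. M1_bound v C)"

definition m1_bound :: "(real \<Rightarrow> real) \<Rightarrow> real \<Rightarrow> bool" where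
  "m1_bound v C \<longleftrightarrow> 0 < C \<and>
     (AE t in half_line. (\<integral>\<^sup>+x. ennreal (v x / x) \<partial>lebesgue_on {t<..}) \<ge> ennreal (C * v t))"

definition m1_class :: "(real \<Rightarrow> real) set" where
  "m1_class = {v. weight v \<and> (\<exists>C. m1_bound v C)}"

text \<open>
  The largest constant exists whenever the tail integrals are finite, in particular for
  \<open>v\<close> in both classes, which is the only case in which it is used.
\<close>

definition m1_const :: "(real \<Rightarrow> real) \<Rightarrow> real" where
  "m1_const v = (GREATEST C. m1_bound v C)"

definition factorization ::
  "(real \<Rightarrow> real) \<Rightarrow> (real \<Rightarrow> real) \<Rightarrow> (real \<Rightarrow> real) \<Rightarrow> (real \<Rightarrow> real) \<Rightarrow> bool" where
  "factorization v h f g \<longleftrightarrow>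
     f \<in> L1_space v \<and> g \<in> Linf_space \<and> (AE x in half_line. h x = f x * g x)"

definition factor_norm :: "(real \<Rightarrow> real) \<Rightarrow> (real \<Rightarrow> real) \<Rightarrow> ennreal" where
  "factor_norm v h = Inf {L1_norm v f * Linf_norm g | f g. factorization v h f g}"

end

theory Submission
  imports Defs
begin

text \<open>
  Write \<open>T t\<close> for the tail integral of \<open>v x / x\<close> over \<open>x > t\<close>. Exchanging the order of
  integration (Tonelli) turns the Cesaro norm into a weighted \<open>L\<^sup>1\<close> norm:
  \<open>Ces1_norm v h\<close> is the integral of \<open>\<bar>h t\<bar> * T t\<close> (\<open>Ces1_norm_eq_tail_weight\<close>). The two class
  conditions say exactly that \<open>T\<close> lies a.e. between two positive constant multiples of \<open>v\<close>, so
  \<open>Ces1_norm v h\<close> lies between the same multiples of \<open>L1_norm v h\<close>, and membership in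
  \<open>Ces1_space v\<close> is membership in \<open>L1_space v\<close>.

  Factoring through \<open>L\<^sup>\<infinity>\<close> adds nothing to \<open>L\<^sup>1\<close>: the trivial factorization \<open>h = h * 1\<close> is optimal,
  because \<open>\<bar>f * g\<bar>\<close> is dominated a.e. by \<open>\<bar>f\<bar>\<close> times the essential supremum of \<open>\<bar>g\<bar>\<close>. Hence
  \<open>factor_norm v h\<close> equals \<open>L1_norm v h\<close> (\<open>factor_norm_eq_L1_norm\<close>).

  To state the bounds with the best constants one has to know that the least, respectively
  greatest, constant exists. A pointwise a.e. inequality survives the passage to a limit of
  countably many constants, so the infimum and the supremum satisfy it too; that the infimum is
  still positive and the supremum finite follows from comparing the two conditions at a single
  point where \<open>v\<close> is positive (\<open>m1_bound_le_M1_bound\<close>).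
\<close>

section \<open>The half-line as a measure space\<close>

lemma sigma_finite_half_line: "sigma_finite_measure half_line"
proof
  let ?A = "range (\<lambda>n::nat. {0<..real n})"
  have sets: "{0<..real n} \<in> sets half_line" for n
    by (subst sets_restrict_space_iff) auto
  have "emeasure half_line {0<..real n} \<noteq> \<infinity>" for n
    by (subst emeasure_restrict_space) auto
  moreover have "\<Union>?A = space half_line"
    by (auto simp: space_restrict_space real_arch_simple)
  ultimately show "\<exists>A. countable A \<and> A \<subseteq> sets half_line \<and> \<Union>A = space half_line \<and>
      (\<forall>a\<in>A. emeasure half_line a \<noteq> \<infinity>)"
    using sets by (intro exI[of _ ?A]) auto
qed

lemma emeasure_half_line_neq_0: "emeasure half_line (space half_line) \<noteq> 0"
proof
  assume "emeasure half_line (space half_line) = 0"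
  then have "emeasure lebesgue {0::real<..} = 0"
    by (simp add: emeasure_restrict_space space_restrict_space)
  moreover have "emeasure lebesgue {0<..1::real} \<le> emeasure lebesgue {0::real<..}"
    by (intro emeasure_mono) auto
  ultimately show False by simp
qed

lemma nn_integral_lebesgue_on_subset_half_line:
  assumes "A \<in> sets lebesgue" "A \<subseteq> {0<..}"
  shows "(\<integral>\<^sup>+x. F x \<partial>lebesgue_on A) = (\<integral>\<^sup>+x. F x * indicator A x \<partial>half_line)"
  using assms
  by (auto simp: nn_integral_restrict_space intro!: nn_integral_cong split: split_indicator)

section \<open>The Cesaro norm as a weighted norm\<close>

definition tail_integral :: "(real \<Rightarrow> real) \<Rightarrow> real \<Rightarrow> ennreal" where
  "tail_integral v t = (\<integral>\<^sup>+x. ennreal (v x / x) \<partial>lebesgue_on {t<..})"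

text \<open>
  Both sides integrate \<open>\<bar>h t\<bar> * v x / x\<close> over the region \<open>0 < t < x\<close>.
\<close>

lemma Ces1_norm_eq_tail_weight:
  assumes v[measurable]: "v \<in> borel_measurable half_line"
    and h[measurable]: "h \<in> borel_measurable half_line"
  shows "Ces1_norm v h = (\<integral>\<^sup>+t. ennreal \<bar>h t\<bar> * tail_integral v t \<partial>half_line)"
proof -
  interpret sigma_finite_measure half_line by (rule sigma_finite_half_line)
  interpret pair_sigma_finite half_line half_line ..
  define F where "F x t = ennreal (v x / x) * ennreal \<bar>h t\<bar> * (if t < x then 1 else 0)" for x t
  have id[measurable]: "(\<lambda>x. x) \<in> borel_measurable half_line"
    by (intro measurable_restrict_space1 measurable_completion) auto
  have F: "case_prod F \<in> borel_measurable (half_line \<Otimes>\<^sub>M half_line)"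
    unfolding F_def by measurable
  have "Ces1_norm v h = (\<integral>\<^sup>+x. (\<integral>\<^sup>+t. F x t \<partial>half_line) \<partial>half_line)"
    unfolding Ces1_norm_def
  proof (intro nn_integral_cong)
    fix x assume "x \<in> space half_line"
    then have x: "0 < x" by (simp add: space_restrict_space)
    have "(\<integral>\<^sup>+t. F x t \<partial>half_line) =
        (\<integral>\<^sup>+t. ennreal (v x / x) * (ennreal \<bar>h t\<bar> * (if t < x then 1 else 0)) \<partial>half_line)"
      by (simp add: F_def mult.assoc)
    also have "\<dots> = ennreal (v x / x) * (\<integral>\<^sup>+t. ennreal \<bar>h t\<bar> * (if t < x then 1 else 0) \<partial>half_line)"
      by (intro nn_integral_cmult) measurable
    also have "(\<integral>\<^sup>+t. ennreal \<bar>h t\<bar> * (if t < x then 1 else 0) \<partial>half_line) =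
        (\<integral>\<^sup>+t. ennreal \<bar>h t\<bar> \<partial>lebesgue_on {0<..<x})"
      by (subst nn_integral_lebesgue_on_subset_half_line)
        (auto intro!: nn_integral_cong simp: space_restrict_space)
    also have "ennreal (v x / x) = ennreal (1 / x) * ennreal (v x)"
      using x by (simp add: ennreal_mult'[symmetric])
    finally show "ennreal (1 / x) * (\<integral>\<^sup>+t. ennreal \<bar>h t\<bar> \<partial>lebesgue_on {0<..<x}) * ennreal (v x) =
        (\<integral>\<^sup>+t. F x t \<partial>half_line)"
      by (simp add: ac_simps)
  qed
  also have "\<dots> = (\<integral>\<^sup>+t. (\<integral>\<^sup>+x. F x t \<partial>half_line) \<partial>half_line)"
    using Fubini'[OF F] by simp
  also have "\<dots> = (\<integral>\<^sup>+t. ennreal \<bar>h t\<bar> * tail_integral v t \<partial>half_line)"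
  proof (intro nn_integral_cong)
    fix t assume "t \<in> space half_line"
    then have t: "0 < t" by (simp add: space_restrict_space)
    have "(\<integral>\<^sup>+x. F x t \<partial>half_line) =
        (\<integral>\<^sup>+x. ennreal \<bar>h t\<bar> * (ennreal (v x / x) * (if t < x then 1 else 0)) \<partial>half_line)"
      by (simp add: F_def ac_simps)
    also have "\<dots> = ennreal \<bar>h t\<bar> * (\<integral>\<^sup>+x. ennreal (v x / x) * (if t < x then 1 else 0) \<partial>half_line)"
      by (intro nn_integral_cmult) measurable
    also have "(\<integral>\<^sup>+x. ennreal (v x / x) * (if t < x then 1 else 0) \<partial>half_line) = tail_integral v t"
      unfolding tail_integral_def using t
      by (subst nn_integral_lebesgue_on_subset_half_line)
        (auto intro!: nn_integral_cong simp: space_restrict_space)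
    finally show "(\<integral>\<^sup>+x. F x t \<partial>half_line) = ennreal \<bar>h t\<bar> * tail_integral v t" .
  qed
  finally show ?thesis .
qed

lemma ennreal_abs_mult_weight:
  assumes "0 < C" "0 < w"
  shows "ennreal \<bar>y\<bar> * ennreal (C * w) = ennreal C * ennreal (\<bar>y\<bar> * w)"
  using assms by (simp add: ennreal_mult[symmetric] mult.left_commute)

lemma Ces1_norm_le_M1_bound:
  assumes v: "weight v" and C: "M1_bound v C"
    and h[measurable]: "h \<in> borel_measurable half_line"
  shows "Ces1_norm v h \<le> ennreal C * L1_norm v h"
proof -
  have [measurable]: "v \<in> borel_measurable half_line" and pos: "AE t in half_line. 0 < v t"
    using v by (auto simp: weight_def)
  have "0 < C" and le: "AE t in half_line. tail_integral v t \<le> ennreal (C * v t)"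
    using C by (auto simp: M1_bound_def tail_integral_def)
  have "Ces1_norm v h = (\<integral>\<^sup>+t. ennreal \<bar>h t\<bar> * tail_integral v t \<partial>half_line)"
    by (rule Ces1_norm_eq_tail_weight) auto
  also have "\<dots> \<le> (\<integral>\<^sup>+t. ennreal C * ennreal (\<bar>h t\<bar> * v t) \<partial>half_line)"
  proof (rule nn_integral_mono_AE)
    show "AE t in half_line. ennreal \<bar>h t\<bar> * tail_integral v t \<le> ennreal C * ennreal (\<bar>h t\<bar> * v t)"
      using le pos
      by eventually_elim
        (simp add: ennreal_abs_mult_weight[OF \<open>0 < C\<close>, symmetric] mult_left_mono)
  qed
  also have "\<dots> = ennreal C * L1_norm v h"
    unfolding L1_norm_def by (intro nn_integral_cmult) measurable
  finally show ?thesis .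
qed

lemma m1_bound_le_Ces1_norm:
  assumes v: "weight v" and C: "m1_bound v C"
    and h[measurable]: "h \<in> borel_measurable half_line"
  shows "ennreal C * L1_norm v h \<le> Ces1_norm v h"
proof -
  have [measurable]: "v \<in> borel_measurable half_line" and pos: "AE t in half_line. 0 < v t"
    using v by (auto simp: weight_def)
  have "0 < C" and le: "AE t in half_line. ennreal (C * v t) \<le> tail_integral v t"
    using C by (auto simp: m1_bound_def tail_integral_def)
  have "ennreal C * L1_norm v h = (\<integral>\<^sup>+t. ennreal C * ennreal (\<bar>h t\<bar> * v t) \<partial>half_line)"
    unfolding L1_norm_def by (intro nn_integral_cmult[symmetric]) measurable
  also have "\<dots> \<le> (\<integral>\<^sup>+t. ennreal \<bar>h t\<bar> * tail_integral v t \<partial>half_line)"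
  proof (rule nn_integral_mono_AE)
    show "AE t in half_line. ennreal C * ennreal (\<bar>h t\<bar> * v t) \<le> ennreal \<bar>h t\<bar> * tail_integral v t"
      using le pos
      by eventually_elim
        (simp add: ennreal_abs_mult_weight[OF \<open>0 < C\<close>, symmetric] mult_left_mono)
  qed
  also have "\<dots> = Ces1_norm v h"
    by (rule Ces1_norm_eq_tail_weight[symmetric]) auto
  finally show ?thesis .
qed

section \<open>The best constants are attained\<close>

text \<open>
  Since the half-line is not a null set, there is a point \<open>t\<close> with \<open>v t > 0\<close> at which both
  inequalities hold; the tail integral at \<open>t\<close> lies between \<open>c * v t\<close> and \<open>C * v t\<close>, and dividing
  by \<open>v t\<close> compares the constants.
\<close>

lemma m1_bound_le_M1_bound:
  assumes "weight v" "m1_bound v c" "M1_bound v C"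
  shows "c \<le> C"
proof -
  have "AE t in half_line. c \<le> C"
  proof -
    have "AE t in half_line. 0 < v t"
      and "AE t in half_line. ennreal (c * v t) \<le> tail_integral v t"
      and "AE t in half_line. tail_integral v t \<le> ennreal (C * v t)"
      using assms by (auto simp: weight_def m1_bound_def M1_bound_def tail_integral_def)
    then show ?thesis
    proof eventually_elim
      case (elim t)
      then have "ennreal (c * v t) \<le> ennreal (C * v t)" by order
      moreover have "0 < C" using assms by (simp add: M1_bound_def)
      ultimately have "c * v t \<le> C * v t" using elim by (simp add: ennreal_le_iff)
      then show ?case using elim by simp
    qed
  qed
  then show ?thesis
    using emeasure_half_line_neq_0 by (simp add: eventually_const ae_filter_eq_bot_iff)
qed

text \<open>
  The exceptional null set depends on the constant, so the infimum is approached along the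
  countably many values \<open>Inf S + 1 / (n + 1)\<close>, whose exceptional sets have a null union. Membership
  in \<open>m1_class\<close> keeps the infimum positive.
\<close>

lemma M1_bound_M1_const:
  assumes "v \<in> M1_class" "v \<in> m1_class"
  shows "M1_bound v (M1_const v)"
proof -
  define S where "S = {C. M1_bound v C}"
  obtain c where c: "m1_bound v c" and v: "weight v"
    using assms by (auto simp: m1_class_def)
  have "S \<noteq> {}" using assms by (auto simp: M1_class_def S_def)
  have lower: "c \<le> C" if "C \<in> S" for C
    using that m1_bound_le_M1_bound[OF v c] by (simp add: S_def)
  then have bdd: "bdd_below S" by (auto simp: bdd_below_def)
  have "c \<le> Inf S" using \<open>S \<noteq> {}\<close> lower by (rule cInf_greatest)
  then have "0 < Inf S" using c by (simp add: m1_bound_def)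
  moreover have "AE t in half_line. tail_integral v t \<le> ennreal (Inf S * v t)"
  proof -
    have "AE t in half_line. tail_integral v t \<le> ennreal ((Inf S + inverse (real (Suc n))) * v t)"
      for n
    proof -
      obtain C where "C \<in> S" and C: "C < Inf S + inverse (real (Suc n))"
        using cInf_lessD[OF \<open>S \<noteq> {}\<close>, of "Inf S + inverse (real (Suc n))"] by auto
      then have "AE t in half_line. tail_integral v t \<le> ennreal (C * v t)"
        by (simp add: S_def M1_bound_def tail_integral_def)
      moreover have "AE t in half_line. 0 < v t" using v by (simp add: weight_def)
      ultimately show ?thesis
      proof eventually_elim
        case (elim t)
        note elim(1)
        also have "ennreal (C * v t) \<le> ennreal ((Inf S + inverse (real (Suc n))) * v t)"
          using C elim(2) by (intro ennreal_leI mult_right_mono) auto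
        finally show ?case .
      qed
    qed
    then have "AE t in half_line. \<forall>n.
        tail_integral v t \<le> ennreal ((Inf S + inverse (real (Suc n))) * v t)"
      by (simp add: AE_all_countable)
    then show ?thesis
    proof eventually_elim
      case (elim t)
      have "(\<lambda>n. ennreal ((Inf S + inverse (real (Suc n))) * v t))
          \<longlonglongrightarrow> ennreal ((Inf S + 0) * v t)"
        by (intro tendsto_intros LIMSEQ_inverse_real_of_nat)
      then show ?case
        using elim by (intro LIMSEQ_le_const[of _ "ennreal (Inf S * v t)"]) auto
    qed
  qed
  ultimately have "M1_bound v (Inf S)" by (simp add: M1_bound_def tail_integral_def)
  moreover have "M1_const v = Inf S"
    unfolding M1_const_def
    using calculation bdd by (intro Least_equality cInf_lower) (auto simp: S_def)
  ultimately show ?thesis by simp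
qed

text \<open>
  The argument for the least constant, reflected: here membership in \<open>M1_class\<close> keeps the
  supremum finite.
\<close>

lemma m1_bound_m1_const:
  assumes "v \<in> M1_class" "v \<in> m1_class"
  shows "m1_bound v (m1_const v)"
proof -
  define S where "S = {c. m1_bound v c}"
  obtain C where C: "M1_bound v C" and v: "weight v"
    using assms by (auto simp: M1_class_def)
  have "S \<noteq> {}" using assms by (auto simp: m1_class_def S_def)
  then obtain c where c: "c \<in> S" by auto
  have bdd: "bdd_above S"
    using m1_bound_le_M1_bound[OF v _ C] by (auto simp: S_def bdd_above_def)
  have "0 < Sup S"
    using c cSup_upper[OF c bdd] by (simp add: S_def m1_bound_def)
  moreover have "AE t in half_line. ennreal (Sup S * v t) \<le> tail_integral v t"
  proof -
    have "AE t in half_line. ennreal ((Sup S - inverse (real (Suc n))) * v t) \<le> tail_integral v t"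
      for n
    proof -
      obtain c where "c \<in> S" and c: "Sup S - inverse (real (Suc n)) < c"
        using less_cSupD[OF \<open>S \<noteq> {}\<close>, of "Sup S - inverse (real (Suc n))"] by auto
      then have "AE t in half_line. ennreal (c * v t) \<le> tail_integral v t"
        by (simp add: S_def m1_bound_def tail_integral_def)
      moreover have "AE t in half_line. 0 < v t" using v by (simp add: weight_def)
      ultimately show ?thesis
      proof eventually_elim
        case (elim t)
        have "ennreal ((Sup S - inverse (real (Suc n))) * v t) \<le> ennreal (c * v t)"
          using c elim(2) by (intro ennreal_leI mult_right_mono) auto
        also note elim(1)
        finally show ?case .
      qed
    qed
    then have "AE t in half_line. \<forall>n.
        ennreal ((Sup S - inverse (real (Suc n))) * v t) \<le> tail_integral v t"
      by (simp add: AE_all_countable)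
    then show ?thesis
    proof eventually_elim
      case (elim t)
      have "(\<lambda>n. ennreal ((Sup S - inverse (real (Suc n))) * v t))
          \<longlonglongrightarrow> ennreal ((Sup S - 0) * v t)"
        by (intro tendsto_intros LIMSEQ_inverse_real_of_nat)
      then show ?case
        using elim by (intro LIMSEQ_le_const2[of _ "ennreal (Sup S * v t)"]) auto
    qed
  qed
  ultimately have "m1_bound v (Sup S)" by (simp add: m1_bound_def tail_integral_def)
  moreover have "m1_const v = Sup S"
    unfolding m1_const_def
    using calculation bdd by (intro Greatest_equality cSup_upper) (auto simp: S_def)
  ultimately show ?thesis by simp
qed

section \<open>Factorizations\<close>

text \<open>
  Hoelder's inequality for the exponents \<open>1\<close> and \<open>\<infinity>\<close>; it is what makes the trivial factorization
  optimal.
\<close>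

lemma L1_norm_le_factorization:
  assumes v: "weight v" and fg: "factorization v h f g"
  shows "L1_norm v h \<le> L1_norm v f * Linf_norm g"
proof -
  have [measurable]: "v \<in> borel_measurable half_line" and pos: "AE t in half_line. 0 < v t"
    using v by (auto simp: weight_def)
  have [measurable]: "f \<in> borel_measurable half_line"
    and eq: "AE x in half_line. h x = f x * g x"
    using fg by (auto simp: factorization_def L1_space_def)
  have bound: "AE x in half_line. ennreal \<bar>g x\<bar> \<le> Linf_norm g"
    unfolding Linf_norm_def by (rule esssup_AE)
  have "L1_norm v h \<le> (\<integral>\<^sup>+x. ennreal (\<bar>f x\<bar> * v x) * Linf_norm g \<partial>half_line)"
    unfolding L1_norm_def
  proof (rule nn_integral_mono_AE)
    show "AE x in half_line. ennreal (\<bar>h x\<bar> * v x) \<le> ennreal (\<bar>f x\<bar> * v x) * Linf_norm g"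
      using pos eq bound
    proof eventually_elim
      case (elim x)
      have "ennreal (\<bar>h x\<bar> * v x) = ennreal (\<bar>f x\<bar> * v x) * ennreal \<bar>g x\<bar>"
        using elim by (simp add: ennreal_mult[symmetric] abs_mult ac_simps)
      then show ?case using elim by (simp add: mult_left_mono)
    qed
  qed
  also have "\<dots> = L1_norm v f * Linf_norm g"
    unfolding L1_norm_def by (intro nn_integral_multc) measurable
  finally show ?thesis .
qed

text \<open>
  The essential supremum of a constant is that constant only because the half-line has positive
  measure; on a null space it would be the bottom element \<open>0\<close>.
\<close>

lemma Linf_norm_one: "Linf_norm (\<lambda>_. 1) = 1"
  unfolding Linf_norm_def using esssup_const[OF emeasure_half_line_neq_0, of "1::ennreal"] by simp

lemma trivial_factorization:
  assumes "h \<in> L1_space v"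
  shows "factorization v h h (\<lambda>_. 1)"
  using assms by (simp add: factorization_def Linf_space_def Linf_norm_one)

lemma L1_space_iff_factorization:
  assumes v: "weight v" and h: "h \<in> borel_measurable half_line"
  shows "h \<in> L1_space v \<longleftrightarrow> (\<exists>f g. factorization v h f g)"
proof
  assume "\<exists>f g. factorization v h f g"
  then obtain f g where fg: "factorization v h f g" by auto
  then have "L1_norm v f * Linf_norm g < \<infinity>"
    by (simp add: factorization_def L1_space_def Linf_space_def ennreal_mult_less_top)
  with L1_norm_le_factorization[OF v fg] h show "h \<in> L1_space v"
    by (simp add: L1_space_def)
qed (use trivial_factorization in blast)

lemma factor_norm_eq_L1_norm:
  assumes "weight v" and "h \<in> L1_space v"
  shows "factor_norm v h = L1_norm v h"
proof (rule antisym)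
  have "L1_norm v h * Linf_norm (\<lambda>_. 1) \<in> {L1_norm v f * Linf_norm g | f g. factorization v h f g}"
    using trivial_factorization[OF assms(2)] by blast
  then have "factor_norm v h \<le> L1_norm v h * Linf_norm (\<lambda>_. 1)"
    unfolding factor_norm_def by (rule Inf_lower)
  then show "factor_norm v h \<le> L1_norm v h" by (simp add: Linf_norm_one)
  show "L1_norm v h \<le> factor_norm v h"
    unfolding factor_norm_def using L1_norm_le_factorization[OF assms(1)]
    by (auto intro!: Inf_greatest)
qed

section \<open>Cesaro functions and factorizations\<close>

lemma Ces1_space_eq_L1_space:
  assumes v: "weight v" and "m1_bound v c" "M1_bound v C"
  shows "Ces1_space v = L1_space v"
proof -
  have "Ces1_norm v h < \<infinity> \<longleftrightarrow> L1_norm v h < \<infinity>" if h: "h \<in> borel_measurable half_line" for h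
  proof
    assume "Ces1_norm v h < \<infinity>"
    then have "ennreal c * L1_norm v h < \<infinity>"
      using m1_bound_le_Ces1_norm[OF v assms(2) h] by order
    then show "L1_norm v h < \<infinity>"
      using assms(2) by (auto simp: m1_bound_def ennreal_mult_less_top)
  next
    assume "L1_norm v h < \<infinity>"
    then have "ennreal C * L1_norm v h < \<infinity>"
      by (simp add: ennreal_mult_less_top)
    then show "Ces1_norm v h < \<infinity>"
      using Ces1_norm_le_M1_bound[OF v assms(3) h] by order
  qed
  then show ?thesis by (auto simp: Ces1_space_def L1_space_def)
qed

theorem theorem3p3:
  fixes v :: "real \<Rightarrow> real"
  assumes "weight v" and "v \<in> M1_class" and "v \<in> m1_class"
  shows "\<forall>h \<in> borel_measurable half_line.
           (h \<in> Ces1_space v \<longleftrightarrow> (\<exists>f g. factorization v h f g)) \<and>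
           (h \<in> Ces1_space v \<longrightarrow>
              ennreal (m1_const v) * factor_norm v h \<le> Ces1_norm v h \<and>
              Ces1_norm v h \<le> ennreal (M1_const v) * factor_norm v h)"
proof -
  note m1 = m1_bound_m1_const[OF assms(2,3)] and M1 = M1_bound_M1_const[OF assms(2,3)]
  show ?thesis
    using Ces1_space_eq_L1_space[OF assms(1) m1 M1] L1_space_iff_factorization[OF assms(1)]
      factor_norm_eq_L1_norm[OF assms(1)]
      m1_bound_le_Ces1_norm[OF assms(1) m1] Ces1_norm_le_M1_bound[OF assms(1) M1]
    by simp
qed

end
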